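(* Let $r\ge 1$ and let $n_1,\dots,n_r$ be nonnegative integers. Then the value $\zeta_r(-n_1,\dots,-n_r)$ of Sadaoui's analytic continuation (defined in the context) satisfies \[ \zeta_r(-n_1,\dots,-n_r)=\prod_{k=1}^{r}(-1)^{n_k}\,\mathcal{C}_{1,\dots,k}^{\,n_k+1}, \] where the right-hand side is evaluated by the symbolic rules in the context; explicitly, \[ \zeta_r(-n_1,\dots,-n_r)=(-1)^{n_1+\dots+n_r}\,V(n_1+1,\dots,n_r+1). \]
   Context: Bernoulli numbers $B_m$ are defined by $\frac{t}{e^t-1}=\sum_{m\ge0}B_m\frac{t^m}{m!}$, so $B_0=1$, $B_1=-\tfrac12$, $B_2=\tfrac16$. The Euler–Zagier multiple zeta function is $\zeta_r(s_1,\dots,s_r)=\sum_{0<k_1<\dots<k_r}k_1^{-s_1}\cdots k_r^{-s_r}$. Sadaoui's analytic continuation to nonpositive integer arguments is given by the following explicit formula. Let $\bar n=\sum_{j=1}^r n_j$. For integers $k_2,\dots,k_r$ put $\bar k=\sum_{j=2}^r k_j$, $m_1=\bar n+r-\bar k$, and for $2\le j\le r$ \[ m_j=\sum_{i=j}^r n_i+(r-j+1)-\sum_{i=j+1}^r k_i . \] Note that $m_j$ depends only on $k_{j+1},\dots,k_r$. The outer sum runs over all tuples $(k_2,\dots,k_r)$ with $0\le k_j\le m_j$ for $j=r,r-1,\dots,2$. Define \[ \zeta_r(-n_1,\dots,-n_r)=(-1)^r\sum_{k_2,\dots,k_r}\frac{1}{m_1}\prod_{j=2}^r\frac{\binom{m_j}{k_j}}{m_j}\sum_{l_1=0}^{m_1}\sum_{l_2=0}^{k_2}\cdots\sum_{l_r=0}^{k_r}\binom{m_1}{l_1}\prod_{j=2}^r\binom{k_j}{l_j}\,B_{l_1}B_{l_2}\cdots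 B_{l_r}. \] For $r=1$ the outer sum and the product are empty and $m_1=n_1+1$. Symbolic calculus. Let $\mathcal{B}_1,\dots,\mathcal{B}_r$ be independent Bernoulli symbols. A monomial $\mathcal{B}_1^{p_1}\cdots\mathcal{B}_r^{p_r}$ is evaluated as $B_{p_1}\cdots B_{p_r}$; in particular $\mathcal{B}_k^p\mathcal{B}_k^q\to B_{p+q}$. The symbols $\mathcal{C}_{1,\dots,k}$ are defined by \[ \mathcal{C}_1^n=\frac{\mathcal{B}_1^n}{n},\qquad \mathcal{C}_{1,\dots,k+1}^n=\frac{(\mathcal{C}_{1,\dots,k}+\mathcal{B}_{k+1})^n}{n}. \] A product of such symbols is evaluated as follows. Expand each $\mathcal{C}$-power binomially, starting from the highest index. Combine powers of the same symbol additively. Only then substitute the lower-level definitions and apply the Bernoulli evaluation rules. Concretely, for positive integers $a_1,\dots,a_k$ the evaluated value $V(a_1,\dots,a_k)$ of $\mathcal{C}_1^{a_1}\mathcal{C}_{1,2}^{a_2}\cdots\mathcal{C}_{1,\dots,k}^{a_k}$ is given recursively by $V(a_1)=B_{a_1}/a_1$ and, for $k\ge2$, \[ V(a_1,\dots,a_k)=\frac{1}{a_k}\sum_{j=0}^{a_k}\binom{a_k}{j}B_{a_k-j}\,V(a_1,\dots,a_{k-2},a_{k-1}+j). \] *)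

theory Defs
  imports
    "HOL-Computational_Algebra.Formal_Power_Series"
    "HOL-Library.Poly_Mapping"
    "HOL-Library.FuncSet"
begin

definition bernoulli :: "nat \<Rightarrow> real" where
  "bernoulli m = fact m * fps_nth (fps_X / (fps_exp 1 - 1)) m"


subsection \<open>Sadaoui's values at nonpositive integers\<close>

text \<open>
  A tuple \<open>(n\<^sub>1, \<dots>, n\<^sub>r)\<close> is a function \<open>n\<close> of which only the values on \<open>{1..r}\<close> matter.
  For \<open>j = 1\<close> the formula below is the separately stated one for \<open>m\<^sub>1\<close>. The subtraction on
  the natural numbers never truncates for the tuples \<open>k\<close> summed over: see
  \<open>sadaoui_m_no_truncation\<close>.
\<close>

definition sadaoui_m :: "nat \<Rightarrow> (nat \<Rightarrow> nat) \<Rightarrow> (nat \<Rightarrow> nat) \<Rightarrow> nat \<Rightarrow> nat" where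
  "sadaoui_m r n k j = (\<Sum>i=j..r. n i) + (r - j + 1) - (\<Sum>i=j+1..r. k i)"

definition sadaoui_tuples :: "nat \<Rightarrow> (nat \<Rightarrow> nat) \<Rightarrow> (nat \<Rightarrow> nat) set" where
  "sadaoui_tuples r n = {k \<in> extensional {2..r}. \<forall>j\<in>{2..r}. k j \<le> sadaoui_m r n k j}"

lemma sadaoui_m_no_truncation:
  assumes k: "k \<in> sadaoui_tuples r n" and j: "1 \<le> j" "j \<le> r"
  shows "(\<Sum>i=j+1..r. k i) < (\<Sum>i=j..r. n i) + (r - j + 1)"
  using j(2,1)
proof (induction j rule: inc_induct)
  case base
  then show ?case by simp
next
  case (step j)
  have "k (Suc j) \<le> sadaoui_m r n k (Suc j)"
    using k step.hyps step.prems by (auto simp: sadaoui_tuples_def)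
  moreover have "(\<Sum>i=Suc j..r. k i) = k (Suc j) + (\<Sum>i=Suc (Suc j)..r. k i)"
    using step.hyps by (simp add: sum.atLeast_Suc_atMost)
  moreover have "(\<Sum>i=j..r. n i) = n j + (\<Sum>i=Suc j..r. n i)"
    using step.hyps by (simp add: sum.atLeast_Suc_atMost)
  ultimately show ?case
    using step.IH step.hyps by (simp add: sadaoui_m_def)
qed

text \<open>\<open>zeta_neg r n\<close> is \<open>\<zeta>\<^sub>r(-n\<^sub>1, \<dots>, -n\<^sub>r)\<close>.\<close>

definition zeta_neg :: "nat \<Rightarrow> (nat \<Rightarrow> nat) \<Rightarrow> real" where
  "zeta_neg r n =
     (-1) ^ r *
     (\<Sum>k\<in>sadaoui_tuples r n.
        1 / real (sadaoui_m r n k 1) *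
        (\<Prod>j=2..r. real (sadaoui_m r n k j choose k j) / real (sadaoui_m r n k j)) *
        (\<Sum>l\<in>(\<Pi>\<^sub>E j\<in>{1..r}. {0..(if j = 1 then sadaoui_m r n k 1 else k j)}).
           real (sadaoui_m r n k 1 choose l 1) *
           (\<Prod>j=2..r. real (k j choose l j)) *
           (\<Prod>j=1..r. bernoulli (l j))))"


subsection \<open>Symbolic calculus\<close>

text \<open>
  \<open>BSym k\<close> stands for \<open>\<B>\<^sub>k\<close> and \<open>CSym k\<close> for \<open>\<C>\<^bsub>1,\<dots>,k\<^esub>\<close>. Symbolic expressions are real
  polynomials in these commuting symbols, so powers of the same symbol combine additively.
\<close>

datatype symbol = BSym nat | CSym nat

type_synonym symbolic = "(symbol \<Rightarrow>\<^sub>0 nat) \<Rightarrow>\<^sub>0 real"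

definition symb :: "symbol \<Rightarrow> symbolic" where
  "symb s = Poly_Mapping.single (Poly_Mapping.single s 1) 1"

definition scalar :: "real \<Rightarrow> symbolic" where
  "scalar c = Poly_Mapping.single 0 c"

text \<open>The defining right-hand side of the \<open>a\<close>-th power of \<open>CSym k\<close>, for positive \<open>a\<close> and \<open>k\<close>.\<close>

definition C_power :: "nat \<Rightarrow> nat \<Rightarrow> symbolic" where
  "C_power k a = scalar (1 / real a) *
     (if k = 1 then symb (BSym 1) else symb (CSym (k - 1)) + symb (BSym k)) ^ a"

text \<open>
  The rule for \<open>CSym k\<close> is not a ring homomorphism: it applies to the full power of \<open>CSym k\<close>
  in each monomial, and a monomial without \<open>CSym k\<close> is left alone.
\<close>

definition expand_monomial :: "nat \<Rightarrow> (symbol \<Rightarrow>\<^sub>0 nat) \<Rightarrow> symbolic" where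
  "expand_monomial k m =
     (let a = Poly_Mapping.lookup m (CSym k) in
      if a = 0 then Poly_Mapping.single m 1
      else Poly_Mapping.single (Poly_Mapping.update (CSym k) 0 m) 1 * C_power k a)"

definition expand_C :: "nat \<Rightarrow> symbolic \<Rightarrow> symbolic" where
  "expand_C k p =
     (\<Sum>m\<in>Poly_Mapping.keys p. scalar (Poly_Mapping.lookup p m) * expand_monomial k m)"

text \<open>Meant for polynomials in the Bernoulli symbols only.\<close>

definition bernoulli_eval :: "symbolic \<Rightarrow> real" where
  "bernoulli_eval p =
     (\<Sum>m\<in>Poly_Mapping.keys p. Poly_Mapping.lookup p m *
        (\<Prod>s\<in>Poly_Mapping.keys m. bernoulli (Poly_Mapping.lookup m s)))"

text \<open>
  \<open>symbolic_eval r\<close> evaluates expressions whose \<open>\<C>\<close>-symbols are among \<open>CSym 1, \<dots>, CSym r\<close>,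
  expanding from the highest index downwards.
\<close>

fun symbolic_eval :: "nat \<Rightarrow> symbolic \<Rightarrow> real" where
  "symbolic_eval 0 p = bernoulli_eval p"
| "symbolic_eval (Suc k) p = symbolic_eval k (expand_C (Suc k) p)"

text \<open>\<open>V k a\<close> is \<open>V(a\<^sub>1, \<dots>, a\<^sub>k)\<close>; the value at \<open>k = 0\<close> is a dummy.\<close>

fun V :: "nat \<Rightarrow> (nat \<Rightarrow> nat) \<Rightarrow> real" where
  "V 0 a = 1"
| "V (Suc 0) a = bernoulli (a 1) / real (a 1)"
| "V (Suc (Suc k)) a =
     1 / real (a (k + 2)) *
     (\<Sum>j=0..a (k + 2). real (a (k + 2) choose j) * bernoulli (a (k + 2) - j) *
        V (Suc k) (a(k + 1 := a (k + 1) + j)))"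

end

theory Submission
  imports Defs
begin

text \<open>
  The reflection identity \<open>\<Sum>l\<le>k. binom(k,l) B\<^sub>l = (-1)\<^sup>k B\<^sub>k\<close> collapses all inner sums of Sadaoui's
  formula. Since \<open>m\<^sub>1 + k\<^sub>2 + \<dots> + k\<^sub>r = n\<^sub>1 + \<dots> + n\<^sub>r + r\<close>, the signs combine to the constant
  \<open>(-1)\<^bsup>n\<^sub>1 + \<dots> + n\<^sub>r\<^esup>\<close>, and what is left is a sum over the tuples \<open>k\<close> alone. Substituting
  \<open>k\<^sub>r = n\<^sub>r + 1 - j\<close> leaves the same sum of depth \<open>r - 1\<close> with \<open>n\<^bsub>r-1\<^esub>\<close> raised by \<open>j\<close>, because
  \<open>m\<^sub>i = n\<^sub>i + 1 + (m\<^bsub>i+1\<^esub> - k\<^bsub>i+1\<^esub>)\<close>; this is the recursion of \<open>V\<close>. The symbolic evaluation is linear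
  and, on a monomial, peels off the highest \<open>\<C>\<close>-symbol by the same recursion, each new power of
  a fresh Bernoulli symbol contributing one factor.
\<close>

subsection \<open>The reflection identity for Bernoulli numbers\<close>

text \<open>Both series have subdegree 1, so the quotient is exact; this is the generating function
  in division-free form.\<close>

lemma bernoulli_fps_mult:
  "fps_X / (fps_exp 1 - 1) * (fps_exp 1 - 1) = (fps_X :: real fps)"
proof -
  have "subdegree (fps_exp 1 - 1 :: real fps) = 1"
    by (rule subdegreeI) auto
  moreover from this have "fps_exp 1 - 1 \<noteq> (0 :: real fps)" by auto
  ultimately have "(fps_exp 1 - 1 :: real fps) dvd fps_X"
    by (simp add: fps_dvd_iff)
  then show ?thesis by simp
qed

lemma bernoulli_0: "bernoulli 0 = 1"
proof -
  \<comment> \<open>The coefficient at index 1 isolates \<open>bernoulli 0\<close>, because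
    \<open>fps_exp 1 - 1\<close> has constant term 0.\<close>
  have "fps_nth (fps_X / (fps_exp 1 - 1) * (fps_exp 1 - 1) :: real fps) 1 = 1"
    by (subst bernoulli_fps_mult) simp
  then show ?thesis
    by (simp add: fps_mult_nth bernoulli_def)
qed

text \<open>In closed form, t e^t / (e^t - 1) = (-t) / (e^(-t) - 1). Substituting -t in the
  division-free identity and cancelling e^t - 1 avoids manipulating quotients.\<close>

lemma bernoulli_fps_reflect:
  defines "F \<equiv> fps_X / (fps_exp 1 - 1) :: real fps"
  shows "F * fps_exp 1 = F oo (- fps_X)"
proof -
  let ?E = "fps_exp 1 :: real fps"
  have "(F * (?E - 1)) oo (- fps_X) = - fps_X"
    unfolding F_def bernoulli_fps_mult by simp
  then have "(F oo (- fps_X)) * (fps_exp (-1) - 1) = - fps_X"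
    by (simp add: fps_compose_mult_distrib fps_compose_sub_distrib fps_compose_uminus)
  then have "(F oo (- fps_X)) * (fps_exp (-1) - 1) * ?E = - fps_X * ?E"
    by simp
  moreover have "fps_exp (-1) * ?E = 1"
    by (simp flip: fps_exp_add_mult)
  ultimately have "(F oo (- fps_X)) * (?E - 1) = fps_X * ?E"
    by algebra
  also have "\<dots> = F * (?E - 1) * ?E"
    unfolding F_def bernoulli_fps_mult ..
  finally have "(F oo (- fps_X)) * (?E - 1) = F * ?E * (?E - 1)"
    by (simp add: mult_ac)
  moreover have "fps_nth (?E - 1) 1 \<noteq> 0" by simp
  then have "?E - 1 \<noteq> 0" by force
  ultimately show ?thesis by (metis mult_right_cancel)
qed

lemma bernoulli_binomial_sum:
  "(\<Sum>l=0..k. real (k choose l) * bernoulli l) = (-1) ^ k * bernoulli k"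
proof -
  let ?F = "fps_X / (fps_exp 1 - 1) :: real fps"
  have "(\<Sum>l=0..k. real (k choose l) * bernoulli l) =
      fact k * (\<Sum>l=0..k. fps_nth ?F l * fps_nth (fps_exp 1) (k - l))"
    unfolding sum_distrib_left
    by (intro sum.cong) (auto simp: bernoulli_def binomial_fact field_simps)
  also have "\<dots> = fact k * fps_nth (?F * fps_exp 1) k"
    by (simp add: fps_mult_nth)
  also have "\<dots> = (-1) ^ k * bernoulli k"
    by (simp add: bernoulli_fps_reflect bernoulli_def fps_compose_uminus')
  finally show ?thesis .
qed

subsection \<open>Sadaoui's sum as the recursion for V\<close>

text \<open>The summand that remains for a tuple \<open>k\<close> once the sums over
  \<open>l\<close> are collapsed and all signs are pulled out.\<close>

definition sadaoui_weight :: "nat \<Rightarrow> (nat \<Rightarrow> nat) \<Rightarrow> (nat \<Rightarrow> nat) \<Rightarrow> real" where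
  "sadaoui_weight r n k =
     bernoulli (sadaoui_m r n k 1) / real (sadaoui_m r n k 1) *
     (\<Prod>j=2..r. real (sadaoui_m r n k j choose k j) / real (sadaoui_m r n k j) * bernoulli (k j))"

text \<open>Makes the total sign exponent independent of \<open>k\<close>, so that the sign leaves
  the outer sum.\<close>

lemma sadaoui_m_1_add_sum:
  assumes "k \<in> sadaoui_tuples r n" and "r \<ge> 1"
  shows "sadaoui_m r n k 1 + (\<Sum>j=2..r. k j) = (\<Sum>i=1..r. n i) + r"
  using sadaoui_m_no_truncation[OF assms(1), of 1] assms(2)
  by (simp add: sadaoui_m_def numeral_2_eq_2)

text \<open>The sum over a box factors into one-variable sums, each given by reflection.\<close>

lemma bernoulli_multi_binomial_sum:
  fixes d :: "nat \<Rightarrow> nat"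
  assumes "finite I"
  shows "(\<Sum>l\<in>(\<Pi>\<^sub>E j\<in>I. {0..d j}). \<Prod>j\<in>I. real (d j choose l j) * bernoulli (l j)) =
         (-1) ^ (\<Sum>j\<in>I. d j) * (\<Prod>j\<in>I. bernoulli (d j))"
proof -
  have "(\<Sum>l\<in>(\<Pi>\<^sub>E j\<in>I. {0..d j}). \<Prod>j\<in>I. real (d j choose l j) * bernoulli (l j)) =
      (\<Prod>j\<in>I. \<Sum>l=0..d j. real (d j choose l) * bernoulli l)"
    using assms by (simp add: prod_sum_PiE)
  then show ?thesis
    by (simp add: bernoulli_binomial_sum prod.distrib power_sum)
qed

lemma zeta_neg_eq_sum_weight:
  assumes "r \<ge> 1"
  shows "zeta_neg r n = (-1) ^ (\<Sum>k=1..r. n k) * (\<Sum>k\<in>sadaoui_tuples r n. sadaoui_weight r n k)"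
proof -
  have split: "{Suc 0..r} = insert (Suc 0) {2..r}"
    using assms by auto
  have inner:
    "(\<Sum>l\<in>(\<Pi>\<^sub>E j\<in>{1..r}. {0..(if j = 1 then sadaoui_m r n k 1 else k j)}).
       real (sadaoui_m r n k 1 choose l 1) * (\<Prod>j=2..r. real (k j choose l j)) *
       (\<Prod>j=1..r. bernoulli (l j))) =
     (-1) ^ (\<Sum>i=1..r. n i) * (-1) ^ r * bernoulli (sadaoui_m r n k 1) * (\<Prod>j=2..r. bernoulli (k j))"
    (is "?lhs = _") if k: "k \<in> sadaoui_tuples r n" for k
  proof -
    define d where "d j = (if j = 1 then sadaoui_m r n k 1 else k j)" for j
    have "?lhs = (\<Sum>l\<in>(\<Pi>\<^sub>E j\<in>{1..r}. {0..d j}). \<Prod>j=1..r. real (d j choose l j) * bernoulli (l j))"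
      by (intro sum.cong) (simp_all add: d_def prod.distrib split)
    also have "\<dots> = (-1) ^ (\<Sum>j=1..r. d j) * (\<Prod>j=1..r. bernoulli (d j))"
      by (rule bernoulli_multi_binomial_sum) simp
    also have "(\<Sum>j=1..r. d j) = (\<Sum>i=1..r. n i) + r"
      unfolding sadaoui_m_1_add_sum[OF k assms, symmetric] by (simp add: split d_def)
    also have "(\<Prod>j=1..r. bernoulli (d j)) = bernoulli (sadaoui_m r n k 1) * (\<Prod>j=2..r. bernoulli (k j))"
      by (simp add: split d_def)
    finally show ?thesis
      by (simp add: power_add)
  qed
  \<comment> \<open>The prefactor of \<open>zeta_neg\<close> cancels the \<open>(-1) ^ r\<close>
    produced by the inner sums.\<close>
  have sq: "(-1) ^ r * ((-1) ^ r * x) = x" for x :: real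
    by (simp flip: mult.assoc power_add)
  show ?thesis
    unfolding zeta_neg_def sum_distrib_left[where A = "sadaoui_tuples r n"]
    by (intro sum.cong refl, subst inner)
       (simp_all add: sadaoui_weight_def prod.distrib prod_dividef sq mult_ac)
qed

section \<open>Recursion of the tuple sum in the depth\<close>

lemma finite_sadaoui_tuples: "finite (sadaoui_tuples r n)"
proof (rule finite_subset)
  show "sadaoui_tuples r n \<subseteq> (\<Pi>\<^sub>E j\<in>{2..r}. {..(\<Sum>i=1..r. n i) + r})"
  proof
    fix k assume k: "k \<in> sadaoui_tuples r n"
    have "k j \<le> (\<Sum>i=1..r. n i) + r" if "j \<in> {2..r}" for j
    proof -
      have "k j \<le> sadaoui_m r n k j"
        using k that by (auto simp: sadaoui_tuples_def)
      also have "\<dots> \<le> (\<Sum>i=j..r. n i) + (r - j + 1)"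
        by (simp add: sadaoui_m_def)
      also have "\<dots> \<le> (\<Sum>i=1..r. n i) + r"
        using that by (intro add_mono sum_mono2) auto
      finally show ?thesis .
    qed
    with k show "k \<in> (\<Pi>\<^sub>E j\<in>{2..r}. {..(\<Sum>i=1..r. n i) + r})"
      by (auto simp: sadaoui_tuples_def PiE_def)
  qed
qed (auto intro: finite_PiE)

lemma sadaoui_m_last: "sadaoui_m r n k r = n r + 1"
  by (simp add: sadaoui_m_def)

lemma sadaoui_m_cong:
  assumes "\<And>i. j < i \<Longrightarrow> i \<le> r \<Longrightarrow> k i = k' i"
  shows "sadaoui_m r n k j = sadaoui_m r n k' j"
  unfolding sadaoui_m_def using assms by (intro arg_cong2[where f = minus] sum.cong) auto

text \<open>The last position contributes \<open>n (Suc r) + 1 - k (Suc r) = j\<close> to every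
  earlier \<open>m\<close>, which has the same effect as raising \<open>n r\<close> by
  \<open>j\<close>.\<close>

lemma sadaoui_m_Suc:
  assumes "1 \<le> r" "i \<le> r" "j \<le> n (Suc r) + 1" "k (Suc r) = n (Suc r) + 1 - j"
  shows "sadaoui_m (Suc r) n k i = sadaoui_m r (n(r := n r + j)) k i"
proof -
  have "(\<Sum>l=i..r. (n(r := n r + j)) l) = (\<Sum>l=i..r. n l + (if l = r then j else 0))"
    by (intro sum.cong) auto
  also have "\<dots> = (\<Sum>l=i..r. n l) + j"
    using assms by (simp add: sum.distrib)
  finally show ?thesis
    using assms by (simp add: sadaoui_m_def)
qed

text \<open>A tuple of depth \<open>Suc r\<close> corresponds to a pair of \<open>j\<close> and a
  tuple of depth \<open>r\<close> for the shifted \<open>n\<close>. The binomial coefficient turns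
  into \<open>choose j\<close> by symmetry.\<close>

lemma sum_sadaoui_weight_Suc:
  assumes "1 \<le> r"
  shows "(\<Sum>k\<in>sadaoui_tuples (Suc r) n. sadaoui_weight (Suc r) n k) =
         (\<Sum>j=0..n (Suc r) + 1. real (n (Suc r) + 1 choose j) / real (n (Suc r) + 1) *
            bernoulli (n (Suc r) + 1 - j) *
            (\<Sum>k\<in>sadaoui_tuples r (n(r := n r + j)). sadaoui_weight r (n(r := n r + j)) k))"
proof -
  define a where "a = n (Suc r) + 1"
  define n' where "n' j = n(r := n r + j)" for j
  define c where "c j = real (a choose j) / real a * bernoulli (a - j)" for j
  have m_upd: "sadaoui_m (Suc r) n (k(Suc r := a - j)) i = sadaoui_m r (n' j) k i"
    if "j \<le> a" "i \<le> r" for k j i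
  proof -
    have "sadaoui_m (Suc r) n (k(Suc r := a - j)) i = sadaoui_m r (n' j) (k(Suc r := a - j)) i"
      unfolding n'_def using assms that by (intro sadaoui_m_Suc) (auto simp: a_def)
    also have "\<dots> = sadaoui_m r (n' j) k i"
      by (intro sadaoui_m_cong) auto
    finally show ?thesis .
  qed
  have set_Suc: "{2..Suc r} = insert (Suc r) {2..r}"
    using assms by auto
  have weight: "sadaoui_weight (Suc r) n (k(Suc r := a - j)) = c j * sadaoui_weight r (n' j) k"
    if "j \<le> a" for k j
  proof -
    have "(a choose (a - j)) = (a choose j)"
      using that by (simp add: binomial_symmetric[symmetric])
    then show ?thesis
      using that assms
      by (simp add: sadaoui_weight_def set_Suc m_upd sadaoui_m_last c_def flip: a_def)
         (simp add: a_def sadaoui_m_last mult_ac)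
  qed
  have "(\<Sum>k\<in>sadaoui_tuples (Suc r) n. sadaoui_weight (Suc r) n k) =
      (\<Sum>(j, k)\<in>(SIGMA j:{0..a}. sadaoui_tuples r (n' j)). c j * sadaoui_weight r (n' j) k)"
  \<comment> \<open>Shortened tuples must be extensional on \<open>{2..r}\<close>, hence the reset
    of position \<open>Suc r\<close> to \<open>undefined\<close>.\<close>
  proof (rule sum.reindex_bij_witness[where
        i = "\<lambda>(j, k). k(Suc r := a - j)" and j = "\<lambda>k. (a - k (Suc r), k(Suc r := undefined))"])
    fix k assume k: "k \<in> sadaoui_tuples (Suc r) n"
    have "k (Suc r) \<le> sadaoui_m (Suc r) n k (Suc r)"
      using k assms unfolding sadaoui_tuples_def by auto
    then have le: "k (Suc r) \<le> a"
      by (simp add: sadaoui_m_last a_def)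
    let ?j = "a - k (Suc r)" and ?k = "k(Suc r := undefined)"
    have k_eq: "?k(Suc r := a - ?j) = k"
      using le by simp
    show "(case (?j, ?k) of (j, k) \<Rightarrow> k(Suc r := a - j)) = k"
      using le by simp
    show "(case (?j, ?k) of (j, k) \<Rightarrow> c j * sadaoui_weight r (n' j) k) = sadaoui_weight (Suc r) n k"
      using weight[of ?j ?k] unfolding k_eq by simp
    have "?k j \<le> sadaoui_m r (n' ?j) ?k j" if "j \<in> {2..r}" for j
    proof -
      have "k j \<le> sadaoui_m (Suc r) n k j"
        using k that by (auto simp: sadaoui_tuples_def)
      then show ?thesis
        using m_upd[of ?j j ?k] that unfolding k_eq by auto
    qed
    moreover have "?k \<in> extensional {2..r}"
      using k by (auto simp: sadaoui_tuples_def extensional_def)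
    ultimately show "(?j, ?k) \<in> (SIGMA j:{0..a}. sadaoui_tuples r (n' j))"
      by (auto simp: sadaoui_tuples_def)
  next
    fix p assume "p \<in> (SIGMA j:{0..a}. sadaoui_tuples r (n' j))"
    then obtain j k where p: "p = (j, k)" and j: "j \<le> a" and k: "k \<in> sadaoui_tuples r (n' j)"
      by auto
    have "k (Suc r) = undefined"
      using k by (auto simp: sadaoui_tuples_def extensional_def)
    then have "k(Suc r := undefined) = k"
      by auto
    then show "(a - (case p of (j, k) \<Rightarrow> k(Suc r := a - j)) (Suc r),
        (case p of (j, k) \<Rightarrow> k(Suc r := a - j))(Suc r := undefined)) = p"
      using j by (simp add: p)
    have "(k(Suc r := a - j)) i \<le> sadaoui_m (Suc r) n (k(Suc r := a - j)) i" if "i \<in> {2..Suc r}" for i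
      using that k j by (cases "i = Suc r") (auto simp: sadaoui_m_last a_def[symmetric] m_upd sadaoui_tuples_def, simp add: a_def)
    then show "(case p of (j, k) \<Rightarrow> k(Suc r := a - j)) \<in> sadaoui_tuples (Suc r) n"
      using k assms by (auto simp: p sadaoui_tuples_def extensional_def)
  qed
  also have "\<dots> = (\<Sum>j=0..a. c j * (\<Sum>k\<in>sadaoui_tuples r (n' j). sadaoui_weight r (n' j) k))"
    by (simp add: sum.Sigma finite_sadaoui_tuples sum_distrib_left)
  finally show ?thesis
    by (simp add: a_def c_def n'_def)
qed

text \<open>Induction on the depth with \<open>n\<close> arbitrary, since each step changes an entry
  of \<open>n\<close>. At depth 1 only the empty tuple occurs.\<close>

lemma sum_sadaoui_weight_eq_V:
  "(\<Sum>k\<in>sadaoui_tuples (Suc r) n. sadaoui_weight (Suc r) n k) = V (Suc r) (\<lambda>k. n k + 1)"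
proof (induction r arbitrary: n)
  case 0
  have "sadaoui_tuples (Suc 0) n = {\<lambda>_. undefined}"
    by (auto simp: sadaoui_tuples_def extensional_def)
  then show ?case
    using sadaoui_m_last[of 1 n] by (simp add: sadaoui_weight_def)
next
  case (Suc r)
  have "(\<lambda>k. (n(Suc r := n (Suc r) + j)) k + 1) = (\<lambda>k. n k + 1)(r + 1 := n (r + 1) + 1 + j)" for j
    by auto
  then show ?case
    by (simp add: sum_sadaoui_weight_Suc Suc.IH sum_distrib_left sum_divide_distrib add_divide_distrib mult_ac)
qed

subsection \<open>Linearity of the symbolic evaluation\<close>

lemma lookup_scalar_mult [simp]:
  "Poly_Mapping.lookup (scalar c * p) m = c * Poly_Mapping.lookup p m"
proof -
  have "Poly_Mapping.lookup (Poly_Mapping.map ((*) c) p) m = c * Poly_Mapping.lookup p m"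
    by transfer (auto simp: when_def)
  then show ?thesis
    by (simp add: scalar_def mult_map_scale_conv_mult)
qed

lemma scalar_0 [simp]: "scalar 0 = 0"
  and scalar_1 [simp]: "scalar 1 = 1"
  and scalar_add: "scalar (c + d) = scalar c + scalar d"
  and scalar_mult: "scalar (c * d) = scalar c * scalar d"
  by (simp_all add: scalar_def single_add mult_single)

lemma scalar_uminus: "scalar (- c) = - scalar c"
  by (simp add: scalar_def single_uminus)

lemma scalar_of_nat: "scalar (of_nat n) = of_nat n"
  by (simp add: scalar_def)

lemma scalar_power: "scalar (c ^ n) = scalar c ^ n"
  by (induction n) (simp_all add: scalar_mult)

lemma symb_power: "symb s ^ n = Poly_Mapping.single (Poly_Mapping.single s n) 1"
  by (induction n) (simp_all add: symb_def mult_single flip: single_add)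

text \<open>Added keys have coefficient 0. A common index set is needed for additivity, as
  cancellation may remove keys from \<open>p + q\<close>.\<close>

lemma expand_C_superset:
  assumes "finite A" "Poly_Mapping.keys p \<subseteq> A"
  shows "expand_C k p = (\<Sum>m\<in>A. scalar (Poly_Mapping.lookup p m) * expand_monomial k m)"
  unfolding expand_C_def using assms
  by (intro sum.mono_neutral_left) (auto simp: in_keys_iff)

lemma bernoulli_eval_superset:
  assumes "finite A" "Poly_Mapping.keys p \<subseteq> A"
  shows "bernoulli_eval p = (\<Sum>m\<in>A. Poly_Mapping.lookup p m *
           (\<Prod>s\<in>Poly_Mapping.keys m. bernoulli (Poly_Mapping.lookup m s)))"
  unfolding bernoulli_eval_def using assms
  by (intro sum.mono_neutral_left) (auto simp: in_keys_iff)

lemma expand_C_add: "expand_C k (p + q) = expand_C k p + expand_C k q"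
proof -
  define A where "A = Poly_Mapping.keys p \<union> Poly_Mapping.keys q"
  have "finite A" "Poly_Mapping.keys p \<subseteq> A" "Poly_Mapping.keys q \<subseteq> A" "Poly_Mapping.keys (p + q) \<subseteq> A"
    using keys_add[of p q] by (auto simp: A_def)
  then show ?thesis
    by (simp add: expand_C_superset lookup_add scalar_add algebra_simps sum.distrib)
qed

lemma bernoulli_eval_add: "bernoulli_eval (p + q) = bernoulli_eval p + bernoulli_eval q"
proof -
  define A where "A = Poly_Mapping.keys p \<union> Poly_Mapping.keys q"
  have "finite A" "Poly_Mapping.keys p \<subseteq> A" "Poly_Mapping.keys q \<subseteq> A" "Poly_Mapping.keys (p + q) \<subseteq> A"
    using keys_add[of p q] by (auto simp: A_def)
  then show ?thesis
    by (simp add: bernoulli_eval_superset lookup_add algebra_simps sum.distrib)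
qed

lemma keys_scalar_mult_subset: "Poly_Mapping.keys (scalar c * p) \<subseteq> Poly_Mapping.keys p"
  by (auto simp: in_keys_iff)

lemma expand_C_scalar_mult: "expand_C k (scalar c * p) = scalar c * expand_C k p"
  unfolding expand_C_superset[OF finite_keys keys_scalar_mult_subset]
  by (simp add: expand_C_def scalar_mult sum_distrib_left mult.assoc)

lemma bernoulli_eval_scalar_mult: "bernoulli_eval (scalar c * p) = c * bernoulli_eval p"
  unfolding bernoulli_eval_superset[OF finite_keys keys_scalar_mult_subset]
  by (simp add: bernoulli_eval_def sum_distrib_left mult.assoc)

text \<open>Linearity reduces the evaluation to single monomials; it is not multiplicative.\<close>

lemma symbolic_eval_add: "symbolic_eval k (p + q) = symbolic_eval k p + symbolic_eval k q"
  by (induction k arbitrary: p q) (simp_all add: expand_C_add bernoulli_eval_add)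

lemma symbolic_eval_scalar_mult: "symbolic_eval k (scalar c * p) = c * symbolic_eval k p"
  by (induction k arbitrary: p) (simp_all add: expand_C_scalar_mult bernoulli_eval_scalar_mult)

lemma symbolic_eval_0: "symbolic_eval k 0 = 0"
  using symbolic_eval_scalar_mult[of k 0 0] by simp

lemma symbolic_eval_sum: "symbolic_eval k (\<Sum>i\<in>I. f i) = (\<Sum>i\<in>I. symbolic_eval k (f i))"
  by (induction I rule: infinite_finite_induct) (simp_all add: symbolic_eval_0 symbolic_eval_add)

subsection \<open>Symbolic evaluation of monomials\<close>

text \<open>Ignoring every \<open>CSym\<close> makes this meaningful for the mixed monomials that
  occur halfway through the expansion.\<close>

definition bernoulli_factor :: "(symbol \<Rightarrow>\<^sub>0 nat) \<Rightarrow> real" where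
  "bernoulli_factor m =
     (\<Prod>s\<in>Poly_Mapping.keys m. case s of BSym _ \<Rightarrow> bernoulli (Poly_Mapping.lookup m s) | CSym _ \<Rightarrow> 1)"

text \<open>Absent symbols have exponent 0 and contribute \<open>bernoulli 0 = 1\<close>.\<close>

lemma bernoulli_factor_superset:
  assumes "finite A" "Poly_Mapping.keys m \<subseteq> A"
  shows "bernoulli_factor m =
    (\<Prod>s\<in>A. case s of BSym _ \<Rightarrow> bernoulli (Poly_Mapping.lookup m s) | CSym _ \<Rightarrow> 1)"
  unfolding bernoulli_factor_def using assms
  by (intro prod.mono_neutral_left) (auto simp: in_keys_iff bernoulli_0 split: symbol.splits)

lemma bernoulli_factor_cong:
  assumes "\<And>i. Poly_Mapping.lookup m (BSym i) = Poly_Mapping.lookup m' (BSym i)"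
  shows "bernoulli_factor m = bernoulli_factor m'"
proof -
  let ?A = "Poly_Mapping.keys m \<union> Poly_Mapping.keys m'"
  have "bernoulli_factor m =
      (\<Prod>s\<in>?A. case s of BSym _ \<Rightarrow> bernoulli (Poly_Mapping.lookup m s) | CSym _ \<Rightarrow> 1)"
    by (rule bernoulli_factor_superset) auto
  also have "\<dots> = (\<Prod>s\<in>?A. case s of BSym _ \<Rightarrow> bernoulli (Poly_Mapping.lookup m' s) | CSym _ \<Rightarrow> 1)"
    using assms by (intro prod.cong) (auto split: symbol.splits)
  also have "\<dots> = bernoulli_factor m'"
    by (rule bernoulli_factor_superset[symmetric]) auto
  finally show ?thesis .
qed

text \<open>Accounts for a fresh Bernoulli symbol; freshness excludes merging with an earlier
  power.\<close>

lemma bernoulli_factor_update: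
  assumes "Poly_Mapping.lookup m (BSym k) = 0"
    and "\<And>i. Poly_Mapping.lookup m' (BSym i) = (if i = k then b else Poly_Mapping.lookup m (BSym i))"
  shows "bernoulli_factor m' = bernoulli b * bernoulli_factor m"
proof -
  let ?A = "Poly_Mapping.keys m \<union> Poly_Mapping.keys m'"
  let ?f = "\<lambda>m s. case s of BSym _ \<Rightarrow> bernoulli (Poly_Mapping.lookup m s) | CSym _ \<Rightarrow> 1"
  have "bernoulli_factor m' = prod (?f m') (insert (BSym k) ?A)"
    by (rule bernoulli_factor_superset) auto
  also have "\<dots> = bernoulli b * prod (?f m') (?A - {BSym k})"
    using assms(2)[of k] by (subst prod.insert_remove) auto
  also have "prod (?f m') (?A - {BSym k}) = prod (?f m) (?A - {BSym k})"
    using assms(2) by (intro prod.cong) (auto split: symbol.splits)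
  also have "\<dots> = bernoulli_factor m"
    using assms(1) by (intro bernoulli_factor_superset[symmetric]) (auto simp: in_keys_iff)
  finally show ?thesis .
qed

lemma bernoulli_eval_single:
  assumes "\<And>i. Poly_Mapping.lookup m (CSym i) = 0"
  shows "bernoulli_eval (Poly_Mapping.single m 1) = bernoulli_factor m"
  unfolding bernoulli_eval_def bernoulli_factor_def using assms
  by (auto intro!: prod.cong simp: in_keys_iff split: symbol.splits)

lemma expand_C_single:
  assumes "Poly_Mapping.lookup m (CSym k) = a" "a > 0"
  shows "expand_C k (Poly_Mapping.single m 1) =
    Poly_Mapping.single (Poly_Mapping.update (CSym k) 0 m) 1 * C_power k a"
  using assms by (simp add: expand_C_def expand_monomial_def)

lemma V_cong:
  assumes "\<And>i. 1 \<le> i \<Longrightarrow> i \<le> k \<Longrightarrow> a i = b i"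
  shows "V k a = V k b"
  using assms
proof (induction k a arbitrary: b rule: V.induct)
  case (3 k a)
  have "V (Suc k) (a(k + 1 := a (k + 1) + j)) = V (Suc k) (b(k + 1 := b (k + 1) + j))"
    if "j \<in> {0..a (k + 2)}" for j
    using that by (intro "3.IH") (auto simp: "3.prems")
  moreover have "a (k + 2) = b (k + 2)"
    by (simp add: "3.prems")
  ultimately show ?case
    by simp
qed simp_all

text \<open>Positive exponents up to \<open>Suc k\<close> ensure that each expansion rule fires; the
  absence of low \<open>BSym\<close> keeps each new Bernoulli symbol fresh. Those of higher index,
  already produced, are carried by \<open>bernoulli_factor\<close>.\<close>

lemma symbolic_eval_single:
  assumes "\<And>i. Poly_Mapping.lookup m (CSym i) > 0 \<longleftrightarrow> 1 \<le> i \<and> i \<le> Suc k"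
    and "\<And>i. i \<le> Suc k \<Longrightarrow> Poly_Mapping.lookup m (BSym i) = 0"
  shows "symbolic_eval (Suc k) (Poly_Mapping.single m 1) =
    V (Suc k) (\<lambda>i. Poly_Mapping.lookup m (CSym i)) * bernoulli_factor m"
  using assms
proof (induction k arbitrary: m)
  case 0
  define a where "a = Poly_Mapping.lookup m (CSym 1)"
  define m' where "m' = Poly_Mapping.update (CSym 1) 0 m + Poly_Mapping.single (BSym 1) a"
  have "a > 0"
    using "0.prems" by (simp add: a_def)
  have "expand_C 1 (Poly_Mapping.single m 1) = scalar (1 / a) * Poly_Mapping.single m' 1"
    unfolding expand_C_single[OF a_def[symmetric] \<open>a > 0\<close>]
    by (simp add: C_power_def symb_power m'_def mult_single mult.left_commute)
  moreover have "bernoulli_eval (Poly_Mapping.single m' 1) = bernoulli_factor m'"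
  proof (rule bernoulli_eval_single)
    show "Poly_Mapping.lookup m' (CSym i) = 0" for i
      using "0.prems"(1)[of i]
      by (cases "i = 1") (auto simp: m'_def lookup_add lookup_update lookup_single)
  qed
  moreover have "bernoulli_factor m' = bernoulli a * bernoulli_factor m"
    using "0.prems"(2)
    by (intro bernoulli_factor_update[where k = 1])
       (auto simp: m'_def lookup_add lookup_update lookup_single when_def)
  ultimately show ?case
    by (simp add: bernoulli_eval_scalar_mult a_def)
next
  case (Suc k)
  define a where "a = Poly_Mapping.lookup m (CSym (Suc (Suc k)))"
  \<comment> \<open>The monomial of the \<open>j\<close>-th binomial term: the power
    \<open>j\<close> of \<open>CSym (Suc k)\<close> merges with the one already in
    \<open>m\<close>.\<close>
  define m' where "m' j = Poly_Mapping.update (CSym (Suc (Suc k))) 0 m +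
    (Poly_Mapping.single (CSym (Suc k)) j + Poly_Mapping.single (BSym (Suc (Suc k))) (a - j))" for j
  let ?e = "\<lambda>i. Poly_Mapping.lookup m (CSym i)"
  have "a > 0"
    using Suc.prems by (simp add: a_def)
  have "C_power (Suc (Suc k)) a = scalar (1 / a) *
      (\<Sum>j=0..a. scalar (real (a choose j)) * symb (CSym (Suc k)) ^ j * symb (BSym (Suc (Suc k))) ^ (a - j))"
    by (simp add: C_power_def binomial_ring scalar_of_nat atMost_atLeast0)
  then have "expand_C (Suc (Suc k)) (Poly_Mapping.single m 1) =
      (\<Sum>j=0..a. scalar (real (a choose j) / a) * Poly_Mapping.single (m' j) 1)"
    unfolding expand_C_single[OF a_def[symmetric] \<open>a > 0\<close>]
    by (simp add: sum_distrib_left symb_power scalar_def mult_single m'_def del: single_of_nat)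
  then have "symbolic_eval (Suc (Suc k)) (Poly_Mapping.single m 1) =
      (\<Sum>j=0..a. real (a choose j) / a * symbolic_eval (Suc k) (Poly_Mapping.single (m' j) 1))"
    by (simp only: symbolic_eval.simps(2)[of "Suc k"] symbolic_eval_sum symbolic_eval_scalar_mult)
  also have "\<dots> = (\<Sum>j=0..a. real (a choose j) / a *
      (V (Suc k) (?e(k + 1 := ?e (k + 1) + j)) * (bernoulli (a - j) * bernoulli_factor m)))"
  proof (rule sum.cong)
    fix j assume "j \<in> {0..a}"
    have "symbolic_eval (Suc k) (Poly_Mapping.single (m' j) 1) =
        V (Suc k) (\<lambda>i. Poly_Mapping.lookup (m' j) (CSym i)) * bernoulli_factor (m' j)"
    proof (rule Suc.IH)
      show "Poly_Mapping.lookup (m' j) (CSym i) > 0 \<longleftrightarrow> 1 \<le> i \<and> i \<le> Suc k" for i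
        using Suc.prems(1)[of i]
        by (auto simp: m'_def lookup_add lookup_update lookup_single when_def)
      show "Poly_Mapping.lookup (m' j) (BSym i) = 0" if "i \<le> Suc k" for i
        using Suc.prems(2)[of i] that
        by (auto simp: m'_def lookup_add lookup_update lookup_single when_def)
    qed
    \<comment> \<open>The two argument functions differ at \<open>Suc (Suc k)\<close>, which
      \<open>V (Suc k)\<close> does not read.\<close>
    also have "V (Suc k) (\<lambda>i. Poly_Mapping.lookup (m' j) (CSym i)) =
        V (Suc k) (?e(k + 1 := ?e (k + 1) + j))"
      by (intro V_cong) (auto simp: m'_def lookup_add lookup_update lookup_single when_def)
    also have "bernoulli_factor (m' j) = bernoulli (a - j) * bernoulli_factor m"
      using Suc.prems(2)
      by (intro bernoulli_factor_update[where k = "Suc (Suc k)"])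
         (auto simp: m'_def lookup_add lookup_update lookup_single when_def)
    finally show "real (a choose j) / a * symbolic_eval (Suc k) (Poly_Mapping.single (m' j) 1) =
        real (a choose j) / a *
        (V (Suc k) (?e(k + 1 := ?e (k + 1) + j)) * (bernoulli (a - j) * bernoulli_factor m))"
      by (rule arg_cong)
  qed simp
  also have "\<dots> = V (Suc (Suc k)) ?e * bernoulli_factor m"
    by (simp add: a_def sum_distrib_left sum_distrib_right mult_ac)
  finally show ?case .
qed

text \<open>Signs are scalars and powers of symbols are monomials, so the whole product is one
  signed monomial.\<close>

lemma prod_signed_symb_CSym:
  "(\<Prod>k\<in>I. (-1) ^ n k * symb (CSym k) ^ (n k + 1)) =
     scalar ((-1) ^ (\<Sum>k\<in>I. n k)) *
     Poly_Mapping.single (\<Sum>k\<in>I. Poly_Mapping.single (CSym k) (n k + 1)) 1"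
proof (induction I rule: infinite_finite_induct)
  case (insert i I)
  have "(-1) ^ n i = scalar ((-1) ^ n i)"
    by (simp add: scalar_power scalar_uminus)
  with insert show ?case
    unfolding prod.insert[OF insert.hyps] sum.insert[OF insert.hyps]
    by (simp add: symb_power power_add scalar_mult mult_ac mult_single del: power_Suc)
qed simp_all

theorem theorem1:
  fixes r :: nat and n :: "nat \<Rightarrow> nat"
  assumes "r \<ge> 1"
  shows "zeta_neg r n =
           symbolic_eval r (\<Prod>k=1..r. (-1) ^ n k * symb (CSym k) ^ (n k + 1))
       \<and> zeta_neg r n = (-1) ^ (\<Sum>k=1..r. n k) * V r (\<lambda>k. n k + 1)"
proof -
  obtain q where r: "r = Suc q"
    using assms by (cases r) auto
  define m where "m = (\<Sum>k=1..r. Poly_Mapping.single (CSym k) (n k + 1))"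
  have C: "Poly_Mapping.lookup m (CSym i) = (if 1 \<le> i \<and> i \<le> r then n i + 1 else 0)" for i
    by (simp add: m_def lookup_sum lookup_single when_def)
  have B: "Poly_Mapping.lookup m (BSym i) = 0" for i
    by (simp add: m_def lookup_sum lookup_single)
  have "symbolic_eval r (Poly_Mapping.single m 1) =
      V r (\<lambda>i. Poly_Mapping.lookup m (CSym i)) * bernoulli_factor m"
    unfolding r by (rule symbolic_eval_single) (simp_all add: C B r)
  also have "V r (\<lambda>i. Poly_Mapping.lookup m (CSym i)) = V r (\<lambda>k. n k + 1)"
    by (rule V_cong) (simp add: C)
  \<comment> \<open>No Bernoulli symbol occurs before expansion, so the factor is that of the empty
    monomial.\<close>
  also have "bernoulli_factor m = bernoulli_factor 0"
    by (rule bernoulli_factor_cong) (simp add: B)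
  also have "\<dots> = 1"
    by (simp add: bernoulli_factor_def)
  finally have "symbolic_eval r (\<Prod>k=1..r. (-1) ^ n k * symb (CSym k) ^ (n k + 1)) =
      (-1) ^ (\<Sum>k=1..r. n k) * V r (\<lambda>k. n k + 1)"
    unfolding prod_signed_symb_CSym symbolic_eval_scalar_mult by (simp add: m_def)
  moreover have "zeta_neg r n = (-1) ^ (\<Sum>k=1..r. n k) * V r (\<lambda>k. n k + 1)"
    using assms by (simp add: zeta_neg_eq_sum_weight r sum_sadaoui_weight_eq_V)
  ultimately show ?thesis
    by simp
qed

end
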